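(* Let $r=(r_n)$, $t=(t_n)$ be scalar sequences with $r_n\neq 0$ and $t_n\neq 0$ for all $n\in\mathbb{N}_0$, and let $s=(s_n)$ be a scalar sequence with $s_0\neq 0$. For each $X\in\{l_\infty,c,c_0\}$, the $\gamma$-dual of $X(r,s,t;\Delta)$ is the set $$\Gamma=\Big\{a=(a_n)\in w:\ \sup_{m}\sum_{n=0}^{\infty}|e_{mn}|<\infty\Big\},$$ where the matrix $E=(e_{mn})$ (depending on $a$) is defined by $$e_{mn}=r_n\bigg[\frac{a_n}{s_0t_n}+\Big(\frac{D_0^{(s)}}{t_n}-\frac{D_1^{(s)}}{t_{n+1}}\Big)\sum_{j=n+1}^{m}a_j+\sum_{j=n+2}^{m}(-1)^{j-n}\frac{D_{j-n}^{(s)}}{t_j}\Big(\sum_{k=j}^{m}a_k\Big)\bigg]\quad\text{for }0\le n\le m,$$ and $e_{mn}=0$ for $n>m$; here a sum whose lower limit exceeds its upper limit is $0$.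
   Context: $\mathbb{N}_0=\{0,1,2,\dots\}$; $w$ is the space of all real (or all complex) sequences $x=(x_n)_{n\in\mathbb{N}_0}$. $l_\infty$, $c$, $c_0$ are the spaces of bounded, convergent and null sequences; $bs$ is the space of sequences whose partial sums are bounded. $\Delta x_k=x_k-x_{k-1}$ with $x_{-1}=0$. For $X\in\{l_\infty,c,c_0\}$, $$X(r,s,t;\Delta)=\Big\{x\in w:\Big(\frac{1}{r_n}\sum_{k=0}^{n}s_{n-k}t_k\Delta x_k\Big)_{n}\in X\Big\}.$$ The numbers $D_n^{(s)}$ are: $D_0^{(s)}=1/s_0$, and for $n\ge1$, $D_n^{(s)}=s_0^{-(n+1)}\det M_n$, where $M_n$ is the $n\times n$ matrix whose $(i,j)$ entry ($1\le i,j\le n$) is $s_{i-j+1}$ if $i-j+1\ge 0$ and $0$ otherwise. The $\gamma$-dual of $U\subset w$ is $U^\gamma=\{a\in w:(a_nu_n)_n\in bs\text{ for all }u\in U\}$. *)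

theory Defs
  imports
    Complex_Main
    "HOL-Library.Extended_Nonnegative_Real"
    "Jordan_Normal_Form.Determinant"
begin

text \<open>
  Scalars range over a type of class \<^class>\<open>real_normed_field\<close>, which treats real and complex
  sequences uniformly. By the Gelfand-Mazur-type theorem of Mazur, the reals and the complex
  numbers are, up to isometric isomorphism, the only such fields. The space \<open>w\<close> of all sequences
  is the whole type \<open>nat \<Rightarrow> 'a\<close>.
\<close>

definition l_inf :: "(nat \<Rightarrow> 'a::real_normed_field) set" where
  "l_inf = {x. Bseq x}"

definition c_conv :: "(nat \<Rightarrow> 'a::real_normed_field) set" where
  "c_conv = {x. convergent x}"

definition c_null :: "(nat \<Rightarrow> 'a::real_normed_field) set" where
  "c_null = {x. x \<longlonglongrightarrow> 0}"

definition bs :: "(nat \<Rightarrow> 'a::real_normed_field) set" where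
  "bs = {x. Bseq (\<lambda>n. \<Sum>k\<le>n. x k)}"

definition bdiff :: "(nat \<Rightarrow> 'a::real_normed_field) \<Rightarrow> nat \<Rightarrow> 'a" where
  "bdiff x k = (if k = 0 then x 0 else x k - x (k - 1))"

definition mean_space ::
  "(nat \<Rightarrow> 'a::real_normed_field) set \<Rightarrow> (nat \<Rightarrow> 'a) \<Rightarrow> (nat \<Rightarrow> 'a) \<Rightarrow> (nat \<Rightarrow> 'a) \<Rightarrow> (nat \<Rightarrow> 'a) set"
where
  "mean_space X r s t = {x. (\<lambda>n. (1 / r n) * (\<Sum>k=0..n. s (n - k) * t k * bdiff x k)) \<in> X}"

text \<open>
  The library's matrices are indexed from \<open>0\<close>. Since the entry \<open>s (i - j + 1)\<close> depends only on
  \<open>i - j\<close>, shifting both indices by one leaves it unchanged; the test \<open>j \<le> i + 1\<close> is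
  \<open>i - j + 1 \<ge> 0\<close> without truncated subtraction.
\<close>

definition D_mat :: "(nat \<Rightarrow> 'a::real_normed_field) \<Rightarrow> nat \<Rightarrow> 'a mat" where
  "D_mat s n = mat n n (\<lambda>(i, j). if j \<le> i + 1 then s (i + 1 - j) else 0)"

definition D :: "(nat \<Rightarrow> 'a::real_normed_field) \<Rightarrow> nat \<Rightarrow> 'a" where
  "D s n = (if n = 0 then 1 / s 0 else det (D_mat s n) / s 0 ^ (n + 1))"

definition gamma_dual :: "(nat \<Rightarrow> 'a::real_normed_field) set \<Rightarrow> (nat \<Rightarrow> 'a) set" where
  "gamma_dual U = {a. \<forall>u\<in>U. (\<lambda>n. a n * u n) \<in> bs}"

definition E ::
  "(nat \<Rightarrow> 'a::real_normed_field) \<Rightarrow> (nat \<Rightarrow> 'a) \<Rightarrow> (nat \<Rightarrow> 'a) \<Rightarrow> (nat \<Rightarrow> 'a) \<Rightarrow> nat \<Rightarrow> nat \<Rightarrow> 'a"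
where
  "E r s t a m n =
    (if n \<le> m then
       r n * (a n / (s 0 * t n)
         + (D s 0 / t n - D s 1 / t (n + 1)) * (\<Sum>j=n+1..m. a j)
         + (\<Sum>j=n+2..m. (-1) ^ (j - n) * (D s (j - n) / t j) * (\<Sum>k=j..m. a k)))
     else 0)"

text \<open>
  The supremum and the row sums are taken in \<open>[0, \<infinity>]\<close>, so that finiteness is not affected by
  default values of divergent real series or unbounded real suprema.
\<close>

definition Gamma_set ::
  "(nat \<Rightarrow> 'a::real_normed_field) \<Rightarrow> (nat \<Rightarrow> 'a) \<Rightarrow> (nat \<Rightarrow> 'a) \<Rightarrow> (nat \<Rightarrow> 'a) set"
where
  "Gamma_set r s t = {a. (SUP m. \<Sum>n. ennreal (norm (E r s t a m n))) < \<infinity>}"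

end

theory Submission
  imports Defs "HOL-Computational_Algebra.Formal_Power_Series"
begin

text \<open>
  Write \<open>y\<close> for the sequence whose membership in \<open>X\<close> defines \<open>x \<in> mean_space X r s t\<close>. The relation
  \<open>r\<^sub>n y\<^sub>n = \<Sum>\<^sub>k s\<^sub>n\<^sub>-\<^sub>k t\<^sub>k \<Delta>x\<^sub>k\<close> is a convolution with \<open>s\<close>, that is, multiplication by the power
  series with coefficients \<open>s\<close>. Because \<open>s\<^sub>0 \<noteq> 0\<close>, this series is invertible, and expanding the
  determinants shows that its inverse has the coefficients \<open>(-1)\<^sup>n D\<^sub>n\<close>
  (\<open>fps_signed_D_inverse\<close>). So \<open>x \<mapsto> y\<close> is a bijection of the space of all sequences, it maps
  \<open>mean_space X r s t\<close> onto \<open>X\<close>, and \<open>\<Delta>x\<close> is an explicit combination of the \<open>y\<^sub>n\<close>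
  (\<open>mean_transform_iff\<close>). Summing by parts and exchanging the order of summation turns
  \<open>\<Sum>\<^sub>j\<^sub>\<le>\<^sub>m a\<^sub>j x\<^sub>j\<close> into \<open>\<Sum>\<^sub>n\<^sub>\<le>\<^sub>m e\<^sub>m\<^sub>n y\<^sub>n\<close>, whose coefficients are those of \<open>E\<close>
  (\<open>E_eq\<close>, \<open>weighted_sum_eq_E\<close>).

  Hence \<open>a\<close> lies in the \<open>\<gamma>\<close>-dual iff the triangular matrix \<open>E\<close> maps \<open>X\<close> into the bounded
  sequences. Since \<open>X\<close> lies between the null and the bounded sequences, it is enough that uniformly
  bounded row sums of norms suffice for bounded \<open>y\<close>, which is the triangle inequality, and are
  already forced by null \<open>y\<close>. The latter, \<open>bounded_rows_if_null_to_bounded\<close>, is an instance of the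
  uniform boundedness principle; as each row has finite support, an explicit gliding hump proves it.
\<close>

section \<open>The numbers \<open>D s n\<close> and the reciprocal power series\<close>

text \<open>
  Deleting the first row and the second column of \<open>D_mat s n\<close> keeps the Toeplitz shape except in the
  first column, which is shifted up. Leaving the first column arbitrary makes the family closed under
  this operation.
\<close>

definition toeplitz_first_col :: "(nat \<Rightarrow> 'a::real_normed_field) \<Rightarrow> (nat \<Rightarrow> 'a) \<Rightarrow> nat \<Rightarrow> 'a mat" where
  "toeplitz_first_col s v n =
     mat n n (\<lambda>(i, j). if j = 0 then v i else if j \<le> i + 1 then s (i + 1 - j) else 0)"

text \<open>
  The first row has only the two entries \<open>v 0\<close> and \<open>s 0\<close>. Expanding along it leaves \<open>D_mat s n\<close> for
  the first entry and a smaller matrix of the same family, with \<open>v\<close> shifted, for the second.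
\<close>

lemma det_toeplitz_first_col:
  "det (toeplitz_first_col s v (Suc n)) = (\<Sum>i\<le>n. (- s 0) ^ i * v i * det (D_mat s (n - i)))"
proof (induction n arbitrary: v)
  case (0 v)
  show ?case
    by (simp add: toeplitz_first_col_def D_mat_def det_single det_dim_zero)
next
  case (Suc n v)
  let ?A = "toeplitz_first_col s v (Suc (Suc n))"
  have A: "?A \<in> carrier_mat (Suc (Suc n)) (Suc (Suc n))"
    by (simp add: toeplitz_first_col_def)
  have del0: "mat_delete ?A 0 0 = D_mat s (Suc n)"
    by (rule eq_matI) (auto simp: toeplitz_first_col_def D_mat_def mat_delete_def Suc_diff_le)
  have del1: "mat_delete ?A 0 1 = toeplitz_first_col s (\<lambda>i. v (Suc i)) (Suc n)"
    by (rule eq_matI) (auto simp: toeplitz_first_col_def mat_delete_def Suc_diff_le)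
  have row: "?A $$ (0, j) = (if j = 0 then v 0 else if j = 1 then s 0 else 0)"
    if "j < Suc (Suc n)" for j
    using that by (auto simp: toeplitz_first_col_def)
  have "det ?A = (\<Sum>j<Suc (Suc n). ?A $$ (0, j) * cofactor ?A 0 j)"
    by (rule laplace_expansion_row[OF A]) simp
  also have "\<dots> = (\<Sum>j\<in>{0, 1}. ?A $$ (0, j) * cofactor ?A 0 j)"
    by (rule sum.mono_neutral_right) (auto simp: row)
  also have "\<dots> = v 0 * det (D_mat s (Suc n))
                - s 0 * det (toeplitz_first_col s (\<lambda>i. v (Suc i)) (Suc n))"
    using del0 del1 by (simp add: row cofactor_def)
  also have "\<dots> = (\<Sum>i\<le>Suc n. (- s 0) ^ i * v i * det (D_mat s (Suc n - i)))"
    unfolding Suc.IH sum.atMost_Suc_shift by (simp add: sum_distrib_left mult.assoc sum_negf)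
  finally show ?case .
qed

lemma det_D_mat_Suc:
  "det (D_mat s (Suc n)) = (\<Sum>i\<le>n. (- s 0) ^ i * s (Suc i) * det (D_mat s (n - i)))"
proof -
  have "D_mat s (Suc n) = toeplitz_first_col s (\<lambda>i. s (Suc i)) (Suc n)"
    by (rule eq_matI) (auto simp: toeplitz_first_col_def D_mat_def)
  then show ?thesis
    by (simp add: det_toeplitz_first_col)
qed

text \<open>The coefficients of the reciprocal of the power series with coefficients \<open>s\<close>.\<close>

definition signed_D :: "(nat \<Rightarrow> 'a::real_normed_field) \<Rightarrow> nat \<Rightarrow> 'a" where
  "signed_D s n = (-1) ^ n * D s n"

text \<open>The case distinction in \<open>D\<close> disappears because the empty determinant is \<open>1\<close>.\<close>

lemma signed_D_eq: "signed_D s n = (-1) ^ n * det (D_mat s n) / s 0 ^ Suc n"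
  by (simp add: signed_D_def D_def D_mat_def det_dim_zero)

text \<open>
  After division by powers of \<open>s 0\<close>, the recurrence for \<open>det (D_mat s n)\<close> is exactly the recurrence
  that determines the coefficients of a reciprocal series.
\<close>

lemma fps_signed_D_inverse:
  assumes "s 0 \<noteq> 0"
  shows "Abs_fps s * Abs_fps (signed_D s) = 1"
proof (rule fps_ext)
  fix n
  show "fps_nth (Abs_fps s * Abs_fps (signed_D s)) n = fps_nth 1 n"
  proof (cases n)
    case 0
    then show ?thesis using assms by (simp add: fps_mult_nth signed_D_eq D_mat_def det_dim_zero)
  next
    case (Suc m)
    have summand: "s 0 * ((-1) ^ Suc m * ((- s 0) ^ i * s (Suc i) * det (D_mat s (m - i))) / s 0 ^ Suc (Suc m))
        = - (s (Suc i) * signed_D s (m - i))" if i: "i \<le> m" for i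
    proof -
      obtain k where k: "m = i + k" using le_Suc_ex[OF i] by blast
      have sign: "(-1) ^ i * (-1) ^ i = (1::'a)"
        by (metis mult_minus1_right minus_minus power_mult_distrib power_one)
      have "s 0 * ((-1) ^ Suc m * ((- s 0) ^ i * s (Suc i) * det (D_mat s k)))
          = ((-1) ^ i * (-1) ^ i) * (s 0 ^ Suc i * - (s (Suc i) * ((-1) ^ k * det (D_mat s k))))"
        by (simp only: k power_Suc power_add power_minus[of "s 0"] mult_minus1 mult_minus_left
              mult_minus_right mult_1_left mult_ac)
      then have num: "s 0 * ((-1) ^ Suc m * ((- s 0) ^ i * s (Suc i) * det (D_mat s k)))
          = s 0 ^ Suc i * - (s (Suc i) * ((-1) ^ k * det (D_mat s k)))"
        by (simp only: sign mult_1_left)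
      have den: "s 0 ^ Suc (Suc m) = s 0 ^ Suc i * s 0 ^ Suc k"
        by (simp add: k power_add)
      have diff: "m - i = k" and nonzero: "s 0 ^ Suc i \<noteq> 0"
        using k assms by simp_all
      show ?thesis
        unfolding diff signed_D_eq times_divide_eq_right num den minus_divide_left
        by (rule nonzero_mult_divide_mult_cancel_left[OF nonzero])
    qed
    have "s 0 * signed_D s (Suc m) = (\<Sum>i\<le>m. - (s (Suc i) * signed_D s (m - i)))"
      unfolding signed_D_eq[of s "Suc m"] det_D_mat_Suc sum_distrib_left sum_divide_distrib
      by (rule sum.cong[OF refl], rule summand) simp
    then show ?thesis
      by (simp add: Suc fps_mult_nth atLeast0AtMost sum.atMost_Suc_shift sum_negf del: sum.atMost_Suc)
  qed
qed

section \<open>Passing from \<open>x\<close> to its transform\<close>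

text \<open>
  Both sides are identities between power series: the left one says that \<open>(r\<^sub>n y\<^sub>n)\<close> is the product of
  \<open>(t\<^sub>k d\<^sub>k)\<close> and \<open>s\<close>, and the right one is obtained by multiplying with the reciprocal of \<open>s\<close>.
\<close>

lemma mean_transform_iff:
  fixes r s t d y :: "nat \<Rightarrow> 'a::real_normed_field"
  assumes r: "\<And>n. r n \<noteq> 0" and t: "\<And>n. t n \<noteq> 0" and s: "s 0 \<noteq> 0"
  shows "(\<forall>n. y n = (1 / r n) * (\<Sum>k=0..n. s (n - k) * t k * d k)) \<longleftrightarrow>
         (\<forall>k. d k = (1 / t k) * (\<Sum>n=0..k. signed_D s (k - n) * (r n * y n)))"
proof -
  let ?S = "Abs_fps s" and ?C = "Abs_fps (signed_D s)"
  let ?d = "Abs_fps (\<lambda>k. t k * d k)" and ?y = "Abs_fps (\<lambda>n. r n * y n)"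
  have inv: "?S * ?C = 1"
    using s by (rule fps_signed_D_inverse)
  have conv_d: "fps_nth (?d * ?S) n = (\<Sum>k=0..n. s (n - k) * t k * d k)" for n
    unfolding fps_mult_nth fps_nth_Abs_fps by (intro sum.cong) (simp_all only: mult_ac)
  have conv_y: "fps_nth (?y * ?C) k = (\<Sum>n=0..k. signed_D s (k - n) * (r n * y n))" for k
    unfolding fps_mult_nth fps_nth_Abs_fps by (intro sum.cong) (simp_all only: mult_ac)
  have cleared: "u = (1 / c) * v \<longleftrightarrow> c * u = v" if "c \<noteq> 0" for c u v :: 'a
    using that by (auto simp: field_simps)
  have "(\<forall>n. y n = (1 / r n) * (\<Sum>k=0..n. s (n - k) * t k * d k)) \<longleftrightarrow> ?y = ?d * ?S"
    by (simp only: cleared[OF r] fps_eq_iff conv_d fps_nth_Abs_fps)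
  also have "\<dots> \<longleftrightarrow> ?d = ?y * ?C"
  proof
    assume "?y = ?d * ?S"
    then have "?y * ?C = ?d * (?S * ?C)" by (simp only: mult.assoc)
    then show "?d = ?y * ?C" by (simp only: inv mult_1_right)
  next
    assume "?d = ?y * ?C"
    then have "?d * ?S = ?y * (?S * ?C)" by (simp only: mult_ac)
    then show "?y = ?d * ?S" by (simp only: inv mult_1_right)
  qed
  also have "\<dots> \<longleftrightarrow> (\<forall>k. d k = (1 / t k) * (\<Sum>n=0..k. signed_D s (k - n) * (r n * y n)))"
    by (simp only: cleared[OF t] fps_eq_iff conv_y fps_nth_Abs_fps)
  finally show ?thesis .
qed

text \<open>
  The definition of \<open>E\<close> singles out the terms \<open>k = n\<close> and \<open>k = n + 1\<close> of one uniform sum, and in the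
  former splits \<open>a n\<close> off the tail \<open>\<Sum>j=n..m. a j\<close>.
\<close>

lemma E_eq:
  fixes r s t a :: "nat \<Rightarrow> 'a::real_normed_field"
  assumes "n \<le> m"
  shows "E r s t a m n = r n * (\<Sum>k=n..m. signed_D s (k - n) / t k * (\<Sum>j=k..m. a j))"
proof -
  let ?f = "\<lambda>k. signed_D s (k - n) / t k * (\<Sum>j=k..m. a j)"
  have split_n: "(\<Sum>k=n..m. ?f k) = ?f n + (\<Sum>k=n+1..m. ?f k)"
    using assms by (simp add: sum.atLeast_Suc_atMost)
  have split_Suc: "(\<Sum>k=n+1..m. ?f k) = ?f (n + 1) + (\<Sum>k=n+2..m. ?f k)"
  proof (cases "n + 1 \<le> m")
    case True
    then show ?thesis by (simp add: sum.atLeast_Suc_atMost)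
  qed simp
  have head: "?f n = D s 0 / t n * (a n + (\<Sum>j=n+1..m. a j))"
    using assms by (simp add: signed_D_def sum.atLeast_Suc_atMost)
  have D0: "D s 0 / t n * a n = a n / (s 0 * t n)"
    by (simp add: D_def)
  show ?thesis
    using assms unfolding split_n split_Suc head E_def distrib_left D0
    by (simp add: signed_D_def algebra_simps)
qed

lemma sum_bdiff: "(\<Sum>k\<le>j. bdiff x k) = x j"
  by (induction j) (auto simp: bdiff_def)

lemma bdiff_partial_sums: "bdiff (\<lambda>j. \<Sum>k\<le>j. d k) k = d k"
  by (cases k) (auto simp: bdiff_def)

lemma sum_triangle_swap:
  fixes f :: "nat \<Rightarrow> nat \<Rightarrow> 'b::comm_monoid_add"
  shows "(\<Sum>j\<le>m. \<Sum>k\<le>j. f j k) = (\<Sum>k\<le>m. \<Sum>j=k..m. f j k)"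
proof -
  have "(\<Sum>j\<le>m. \<Sum>k\<le>j. f j k) = (\<Sum>j\<le>m. \<Sum>k | k \<in> {..m} \<and> k \<le> j. f j k)"
    by (intro sum.cong) auto
  also have "\<dots> = (\<Sum>k\<le>m. \<Sum>j | j \<in> {..m} \<and> k \<le> j. f j k)"
    by (rule sum.swap_restrict) auto
  also have "\<dots> = (\<Sum>k\<le>m. \<Sum>j=k..m. f j k)"
    by (intro sum.cong) auto
  finally show ?thesis .
qed

text \<open>
  Each \<open>d k\<close> is multiplied by the tail \<open>\<Sum>j=k..m. a j\<close>; substituting its expression in \<open>y\<close> and
  collecting the coefficient of \<open>y n\<close> gives the uniform form of \<open>E\<close>.
\<close>

lemma weighted_sum_eq_E:
  fixes r s t a d y :: "nat \<Rightarrow> 'a::real_normed_field"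
  assumes d: "\<And>k. d k = (1 / t k) * (\<Sum>n=0..k. signed_D s (k - n) * (r n * y n))"
  shows "(\<Sum>j\<le>m. a j * (\<Sum>k\<le>j. d k)) = (\<Sum>n\<le>m. E r s t a m n * y n)"
proof -
  let ?g = "\<lambda>n k. signed_D s (k - n) / t k * (\<Sum>j=k..m. a j) * (r n * y n)"
  have "(\<Sum>j\<le>m. a j * (\<Sum>k\<le>j. d k)) = (\<Sum>j\<le>m. \<Sum>k\<le>j. a j * d k)"
    by (simp add: sum_distrib_left)
  also have "\<dots> = (\<Sum>k\<le>m. \<Sum>j=k..m. a j * d k)"
    by (rule sum_triangle_swap)
  also have "\<dots> = (\<Sum>k\<le>m. \<Sum>n\<le>k. ?g n k)"
  proof (rule sum.cong[OF refl])
    fix k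
    \<comment> \<open>Naming the tail keeps \<open>sum_distrib_left\<close> from distributing over it.\<close>
    define A where "A = (\<Sum>j=k..m. a j)"
    have "(\<Sum>j=k..m. a j * d k) = A * d k"
      by (simp only: A_def sum_distrib_right)
    also have "\<dots> = (\<Sum>n\<le>k. signed_D s (k - n) / t k * A * (r n * y n))"
      by (simp add: d[of k] sum_distrib_left atLeast0AtMost mult_ac)
    finally show "(\<Sum>j=k..m. a j * d k) = (\<Sum>n\<le>k. ?g n k)"
      by (simp only: A_def)
  qed
  also have "\<dots> = (\<Sum>n\<le>m. \<Sum>k=n..m. ?g n k)"
    by (rule sum_triangle_swap)
  also have "\<dots> = (\<Sum>n\<le>m. E r s t a m n * y n)"
  proof (rule sum.cong[OF refl])
    fix n assume "n \<in> {..m}"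
    then have "E r s t a m n * y n
        = (\<Sum>k=n..m. signed_D s (k - n) / t k * (\<Sum>j=k..m. a j)) * (r n * y n)"
      by (simp add: E_eq mult_ac)
    then show "(\<Sum>k=n..m. ?g n k) = E r s t a m n * y n"
      by (simp only: sum_distrib_right)
  qed
  finally show ?thesis .
qed

text \<open>
  Since \<open>x \<mapsto> y\<close> is onto \<open>X\<close>, testing \<open>a\<close> against all \<open>x\<close> in the space is the same as testing the rows
  of \<open>E\<close> against all \<open>y \<in> X\<close>.
\<close>

lemma gamma_dual_mean_space_iff:
  fixes r s t a :: "nat \<Rightarrow> 'a::real_normed_field"
  assumes "\<And>n. r n \<noteq> 0" and "\<And>n. t n \<noteq> 0" and "s 0 \<noteq> 0"
  shows "a \<in> gamma_dual (mean_space X r s t) \<longleftrightarrow>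
         (\<forall>y\<in>X. Bseq (\<lambda>m. \<Sum>n\<le>m. E r s t a m n * y n))"
proof
  assume dual: "a \<in> gamma_dual (mean_space X r s t)"
  show "\<forall>y\<in>X. Bseq (\<lambda>m. \<Sum>n\<le>m. E r s t a m n * y n)"
  proof
    fix y assume "y \<in> X"
    define d where "d k = (1 / t k) * (\<Sum>n=0..k. signed_D s (k - n) * (r n * y n))" for k
    let ?x = "\<lambda>j. \<Sum>k\<le>j. d k"
    have "\<forall>n. y n = (1 / r n) * (\<Sum>k=0..n. s (n - k) * t k * d k)"
      unfolding mean_transform_iff[of r t s y d, OF assms] using d_def by blast
    then have "y = (\<lambda>n. (1 / r n) * (\<Sum>k=0..n. s (n - k) * t k * bdiff ?x k))"
      unfolding bdiff_partial_sums by blast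
    with \<open>y \<in> X\<close> have "?x \<in> mean_space X r s t"
      by (simp add: mean_space_def)
    with dual have "(\<lambda>j. a j * ?x j) \<in> bs"
      unfolding gamma_dual_def mem_Collect_eq by (rule bspec)
    then show "Bseq (\<lambda>m. \<Sum>n\<le>m. E r s t a m n * y n)"
      by (simp only: bs_def mem_Collect_eq weighted_sum_eq_E[OF d_def])
  qed
next
  assume bounded: "\<forall>y\<in>X. Bseq (\<lambda>m. \<Sum>n\<le>m. E r s t a m n * y n)"
  show "a \<in> gamma_dual (mean_space X r s t)"
    unfolding gamma_dual_def bs_def
  proof (intro CollectI ballI)
    fix x assume x: "x \<in> mean_space X r s t"
    define y where "y n = (1 / r n) * (\<Sum>k=0..n. s (n - k) * t k * bdiff x k)" for n
    have "y \<in> X"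
      using x by (simp add: mean_space_def y_def[abs_def])
    have d: "bdiff x k = (1 / t k) * (\<Sum>n=0..k. signed_D s (k - n) * (r n * y n))" for k
      using mean_transform_iff[of r t s y "bdiff x", OF assms] y_def by blast
    show "Bseq (\<lambda>m. \<Sum>k\<le>m. a k * x k)"
      using bounded \<open>y \<in> X\<close> weighted_sum_eq_E[OF d, of a] by (simp add: sum_bdiff)
  qed
qed

section \<open>Triangular matrices mapping null sequences to bounded ones\<close>

lemma Bseq_transform_if_bounded_rows:
  fixes M :: "nat \<Rightarrow> nat \<Rightarrow> 'a::real_normed_field"
  assumes K: "\<And>m. (\<Sum>n\<le>m. norm (M m n)) \<le> K" and "Bseq y"
  shows "Bseq (\<lambda>m. \<Sum>n\<le>m. M m n * y n)"
proof -
  obtain B where B: "B > 0" "\<And>n. norm (y n) \<le> B"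
    using \<open>Bseq y\<close> by (auto simp: Bseq_def)
  have "norm (\<Sum>n\<le>m. M m n * y n) \<le> K * B" for m
  proof -
    have "norm (\<Sum>n\<le>m. M m n * y n) \<le> (\<Sum>n\<le>m. norm (M m n) * B)"
      by (rule sum_norm_le) (simp add: norm_mult B mult_left_mono)
    also have "\<dots> \<le> K * B"
      using K[of m] B(1) by (simp flip: sum_distrib_right)
    finally show ?thesis .
  qed
  then show ?thesis by (rule BseqI')
qed

text \<open>
  Suppose that the row sums are unbounded. Unit sequences show that every column is bounded, say by
  \<open>C n\<close>, so initial segments of length \<open>N\<close> contribute at most \<open>B N\<close> to any row. Choose rows
  successively so that the \<open>k\<close>-th one is huge compared with \<open>k\<close> and with the bound \<open>B N\<close> for the
  columns before its block, and let \<open>y\<close> have size \<open>1 / (k + 1)\<close> on the block wherever the row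
  does not vanish, with phases that align all terms of the row. Then \<open>y\<close> is null, but the chosen rows applied to \<open>y\<close> exceed every \<open>k\<close>. There
  is no tail to control, since a row ends where its block ends.
\<close>

lemma bounded_rows_if_null_to_bounded:
  fixes M :: "nat \<Rightarrow> nat \<Rightarrow> 'a::real_normed_field"
  assumes bounded: "\<And>y. y \<longlonglongrightarrow> 0 \<Longrightarrow> Bseq (\<lambda>m. \<Sum>n\<le>m. M m n * y n)"
  shows "\<exists>K. \<forall>m. (\<Sum>n\<le>m. norm (M m n)) \<le> K"
proof (rule ccontr)
  assume "\<not> ?thesis"
  then have unbounded: "\<exists>m. K < (\<Sum>n\<le>m. norm (M m n))" for K
    by (meson not_le)
  have "\<exists>C. \<forall>m\<ge>n. norm (M m n) \<le> C" for n
  proof -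
    have "(\<lambda>i. if i = n then 1 else 0 :: 'a) \<longlonglongrightarrow> 0"
      by (rule tendsto_eventually) (use eventually_gt_at_top[of n] in \<open>eventually_elim, auto\<close>)
    from bounded[OF this] obtain C
      where C: "\<And>m. norm (\<Sum>i\<le>m. M m i * (if i = n then 1 else 0)) \<le> C"
      by (auto simp: Bseq_def)
    have "norm (M m n) \<le> C" if "n \<le> m" for m
      using C[of m] that by (simp add: sum.delta if_distrib cong: if_cong)
    then show ?thesis by blast
  qed
  then obtain C where C: "\<And>n m. n \<le> m \<Longrightarrow> norm (M m n) \<le> C n"
    by metis
  define B where "B N = (\<Sum>n<N. C n)" for N
  have C_nonneg: "0 \<le> C n" for n
    using C[of n n] norm_ge_zero order_trans by blast
  then have B_nonneg: "0 \<le> B N" for N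
    by (simp add: B_def sum_nonneg)
  \<comment> \<open>A block \<open>[N, N')\<close> ending at the diagonal entry of its row \<open>m\<close>. The threshold ensures that the
    part of the row in the block, divided by \<open>k + 1\<close>, still exceeds \<open>k + B N\<close>.\<close>
  define hump where
    "hump k N N' \<longleftrightarrow> (\<exists>m. N' = Suc m \<and> N \<le> m \<and>
       real (Suc k) * (real k + B N) + B N < (\<Sum>n\<le>m. norm (M m n)))" for k N N'
  have step: "\<exists>N'. hump k N N'" for k N
  proof -
    obtain m where m: "real (Suc k) * (real k + B N) + B N < (\<Sum>n\<le>m. norm (M m n))"
      using unbounded by blast
    \<comment> \<open>Rows shorter than \<open>N\<close> lie wholly in the first \<open>N\<close> columns, so their sums are at most \<open>B N\<close>.\<close>
    have "N \<le> m"
    proof (rule ccontr)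
      assume "\<not> N \<le> m"
      then have "(\<Sum>n\<le>m. norm (M m n)) \<le> B N"
        unfolding B_def
        by (intro order_trans[OF sum_mono[of _ _ C] sum_mono2]) (auto simp: C C_nonneg)
      moreover have "0 \<le> real (Suc k) * (real k + B N)"
        using B_nonneg[of N] by simp
      ultimately show False
        using m by linarith
    qed
    with m show ?thesis by (auto simp: hump_def)
  qed
  obtain p where p: "\<And>k. hump k (p k) (p (Suc k))"
    using dependent_nat_choice[of "\<lambda>_ _. True" hump] step by auto
  have "strict_mono p"
    unfolding strict_mono_Suc_iff using p unfolding hump_def by (metis le_imp_less_Suc)
  \<comment> \<open>The index of the block \<open>[p k, p (k + 1))\<close> containing \<open>n\<close>.\<close>
  define blk where "blk n = (LEAST k. n < p (Suc k))" for n
  have blk_eq: "blk n = k" if "p k \<le> n" "n < p (Suc k)" for n k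
    unfolding blk_def
  proof (rule Least_equality)
    fix l assume "n < p (Suc l)"
    with that(1) have "p k < p (Suc l)" by simp
    then show "k \<le> l"
      using \<open>strict_mono p\<close> by (simp add: strict_mono_less)
  qed (fact that(2))
  have blk_ge: "k \<le> blk n" if "p k \<le> n" for n k
  proof -
    have "n < p (Suc n)"
      using strict_mono_imp_increasing[OF \<open>strict_mono p\<close>, of "Suc n"] by simp
    then have "n < p (Suc (blk n))"
      unfolding blk_def by (rule LeastI)
    with that have "p k < p (Suc (blk n))" by simp
    then show ?thesis
      using \<open>strict_mono p\<close> by (simp add: strict_mono_less)
  qed
  \<comment> \<open>The entry in column \<open>n\<close> of the row chosen for the block of \<open>n\<close>. If it vanishes, so does \<open>y n\<close>,
    because division by \<open>0\<close> gives \<open>0\<close>.\<close>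
  define e where "e n = M (p (Suc (blk n)) - 1) n" for n
  define y where "y n = of_real (norm (e n) / real (Suc (blk n))) / e n" for n
  have norm_y: "norm (y n) \<le> 1 / real (Suc (blk n))" for n
    by (cases "e n = 0") (simp_all add: y_def norm_divide norm_mult del: of_nat_Suc)
  have "filterlim blk at_top sequentially"
    unfolding filterlim_at_top eventually_sequentially using blk_ge by blast
  then have "(\<lambda>n. inverse (real (Suc (blk n)))) \<longlonglongrightarrow> 0"
    by (rule filterlim_compose[OF LIMSEQ_inverse_real_of_nat])
  then have "y \<longlonglongrightarrow> 0"
    by (rule tendsto_0_le[where K = 1]) (use norm_y in \<open>simp add: inverse_eq_divide del: of_nat_Suc\<close>)
  from bounded[OF this] obtain L where L: "\<And>m. norm (\<Sum>n\<le>m. M m n * y n) \<le> L"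
    by (auto simp: Bseq_def)
  obtain k :: nat where "L < real k"
    using reals_Archimedean2 by blast
  obtain m where m: "p (Suc k) = Suc m" "p k \<le> m"
    and big: "real (Suc k) * (real k + B (p k)) + B (p k) < (\<Sum>n\<le>m. norm (M m n))"
    using p[of k] by (auto simp: hump_def)
  let ?h = "\<Sum>n=p k..m. norm (M m n)"
  have split: "(\<Sum>n\<le>m. f n) = (\<Sum>n<p k. f n) + (\<Sum>n=p k..m. f n)" for f :: "nat \<Rightarrow> 'b::comm_monoid_add"
  proof -
    have "{..m} = {..<p k} \<union> {p k..m}" using m(2) by auto
    then show ?thesis by (simp add: sum.union_disjoint ivl_disj_int)
  qed
  have head: "(\<Sum>n<p k. norm (M m n)) \<le> B (p k)"
    unfolding B_def using m(2) by (intro sum_mono) (simp add: C)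
  have hump_term: "M m n * y n = of_real (norm (M m n) / real (Suc k))" if "n \<in> {p k..m}" for n
  proof -
    have "blk n = k" using that m(1) by (intro blk_eq) auto
    then have "e n = M m n" using m(1) by (simp add: e_def)
    then show ?thesis using \<open>blk n = k\<close> by (simp add: y_def)
  qed
  have "(\<Sum>n=p k..m. M m n * y n) = (\<Sum>n=p k..m. of_real (norm (M m n) / real (Suc k)))"
    by (rule sum.cong[OF refl]) (rule hump_term)
  also have "\<dots> = of_real (?h / real (Suc k))"
    by (simp only: of_real_sum sum_divide_distrib)
  finally have hump_sum: "norm (\<Sum>n=p k..m. M m n * y n) = ?h / real (Suc k)"
    by (simp add: norm_divide sum_nonneg del: of_real_divide of_real_sum of_nat_Suc)
  have "norm (\<Sum>n<p k. M m n * y n) \<le> (\<Sum>n<p k. norm (M m n))"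
  proof (rule sum_norm_le)
    fix n
    have "norm (y n) \<le> 1"
      using norm_y[of n] by (rule order_trans) simp
    then show "norm (M m n * y n) \<le> norm (M m n)"
      by (simp add: norm_mult mult_left_le)
  qed
  also note head
  finally have head_sum: "norm (\<Sum>n<p k. M m n * y n) \<le> B (p k)" .
  have "real (Suc k) * (real k + B (p k)) < ?h"
    using big head split[of "\<lambda>n. norm (M m n)"] by linarith
  then have "real k + B (p k) < ?h / real (Suc k)"
    by (simp add: pos_less_divide_eq mult.commute del: of_nat_Suc)
  moreover have "?h / real (Suc k) - B (p k) \<le> norm (\<Sum>n\<le>m. M m n * y n)"
    unfolding split[of "\<lambda>n. M m n * y n"] using hump_sum head_sum
      norm_diff_ineq[of "\<Sum>n=p k..m. M m n * y n" "\<Sum>n<p k. M m n * y n"]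
    by (simp add: add.commute)
  ultimately show False
    using L[of m] \<open>L < real k\<close> by linarith
qed

section \<open>The \<open>\<gamma>\<close>-dual\<close>

text \<open>
  Rows of \<open>E\<close> vanish beyond the diagonal, so the extended-real series are finite sums and the
  supremum can be replaced by a real bound.
\<close>

lemma Gamma_set_iff:
  "a \<in> Gamma_set r s t \<longleftrightarrow> (\<exists>K. \<forall>m. (\<Sum>n\<le>m. norm (E r s t a m n)) \<le> K)"
proof -
  have row: "(\<Sum>n. ennreal (norm (E r s t a m n))) = ennreal (\<Sum>n\<le>m. norm (E r s t a m n))" for m
    by (subst suminf_finite[of "{..m}"]) (auto simp: E_def sum_ennreal)
  show ?thesis
  proof
    assume "a \<in> Gamma_set r s t"
    then have "(SUP m. ennreal (\<Sum>n\<le>m. norm (E r s t a m n))) < \<infinity>"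
      by (simp only: Gamma_set_def row mem_Collect_eq)
    then obtain K where K: "0 \<le> K" "(SUP m. ennreal (\<Sum>n\<le>m. norm (E r s t a m n))) = ennreal K"
      by (cases "SUP m. ennreal (\<Sum>n\<le>m. norm (E r s t a m n))" rule: ennreal_cases) auto
    have "(\<Sum>n\<le>m. norm (E r s t a m n)) \<le> K" for m
    proof -
      have "ennreal (\<Sum>n\<le>m. norm (E r s t a m n)) \<le> ennreal K"
        unfolding K(2)[symmetric] by (rule SUP_upper) simp
      with K(1) show ?thesis by simp
    qed
    then show "\<exists>K. \<forall>m. (\<Sum>n\<le>m. norm (E r s t a m n)) \<le> K" by blast
  next
    assume "\<exists>K. \<forall>m. (\<Sum>n\<le>m. norm (E r s t a m n)) \<le> K"
    then obtain K where "\<And>m. (\<Sum>n\<le>m. norm (E r s t a m n)) \<le> K" by blast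
    then have "(SUP m. ennreal (\<Sum>n\<le>m. norm (E r s t a m n))) \<le> ennreal K"
      by (intro SUP_least ennreal_leI)
    also have "\<dots> < \<infinity>" by simp
    finally show "a \<in> Gamma_set r s t"
      by (simp only: Gamma_set_def row mem_Collect_eq)
  qed
qed

theorem theorem4p6:
  fixes r s t :: "nat \<Rightarrow> 'a::real_normed_field"
    and X :: "(nat \<Rightarrow> 'a) set"
  assumes "\<And>n. r n \<noteq> 0"
    and "\<And>n. t n \<noteq> 0"
    and "s 0 \<noteq> 0"
    and "X \<in> {l_inf, c_conv, c_null}"
  shows "gamma_dual (mean_space X r s t) = Gamma_set r s t"
proof (rule Set.set_eqI)
  fix a
  have null: "y \<in> X" if "y \<longlonglongrightarrow> 0" for y
    using assms(4) that convergentI[OF that] convergent_imp_Bseq[of y]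
    by (auto simp: l_inf_def c_conv_def c_null_def)
  have Bseq: "Bseq y" if "y \<in> X" for y
    using assms(4) that convergentI[of y 0] convergent_imp_Bseq[of y]
    by (auto simp: l_inf_def c_conv_def c_null_def)
  have "(\<forall>y\<in>X. Bseq (\<lambda>m. \<Sum>n\<le>m. E r s t a m n * y n)) \<longleftrightarrow>
        (\<exists>K. \<forall>m. (\<Sum>n\<le>m. norm (E r s t a m n)) \<le> K)"
  proof
    assume "\<forall>y\<in>X. Bseq (\<lambda>m. \<Sum>n\<le>m. E r s t a m n * y n)"
    with null show "\<exists>K. \<forall>m. (\<Sum>n\<le>m. norm (E r s t a m n)) \<le> K"
      by (intro bounded_rows_if_null_to_bounded) blast
  next
    assume "\<exists>K. \<forall>m. (\<Sum>n\<le>m. norm (E r s t a m n)) \<le> K"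
    then obtain K where "\<And>m. (\<Sum>n\<le>m. norm (E r s t a m n)) \<le> K" by blast
    with Bseq show "\<forall>y\<in>X. Bseq (\<lambda>m. \<Sum>n\<le>m. E r s t a m n * y n)"
      by (blast intro: Bseq_transform_if_bounded_rows)
  qed
  then show "a \<in> gamma_dual (mean_space X r s t) \<longleftrightarrow> a \<in> Gamma_set r s t"
    unfolding gamma_dual_mean_space_iff[of r t s, OF assms(1-3)] Gamma_set_iff .
qed

end
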